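(* Let $n\ge 1$, $\mathcal N=\{1,\dots,n\}$, let $C>0$ be a real number, and for each $k\in\mathcal N$ let $u_k\ge 0$ be a real number and $S_k\in\mathbb C$ a nonzero complex number with $|S_k|\le C$. Let $\theta$ be the maximum angle between any pair of the demands $S_1,\dots,S_n$ (viewed as vectors in the plane), and assume $0\le\theta\le\frac{\pi}{2}$. Then the Greedy Ratio Algorithm (GRA), applied to this instance of the problem UMDR (with ties broken arbitrarily), outputs a set $\hat X\subseteq\mathcal N$ that is a feasible solution within a worst-case guarantee of $\frac12\cos\frac{\theta}{2}$ of the optimum, that is, $$\Big|\sum_{k\in \hat X}S_k\Big|\le C\qquad\text{and}\qquad \sum_{k\in\hat X}u_k\;\ge\;\tfrac12\cos\tfrac{\theta}{2}\cdot \mathrm{Opt},$$ where $\mathrm{Opt}$ is the optimal value of UMDR on this instance.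
   Context: Problem UMDR (Utility Maximizing Demand Response): given customers $\mathcal N=\{1,\dots,n\}$, utilities $u_k$, complex-valued power demands $S_k=P_k+\mathbf i Q_k$ and capacity $C$, maximize $\sum_{k\in\mathcal N}u_kx_k$ over $x_k\in\{0,1\}$ ($k\in\mathcal N$) subject to $\big|\sum_{k\in\mathcal N}S_kx_k\big|\le C$. A choice $(x_k)$ is identified with the set $X=\{k\in\mathcal N: x_k=1\}$; $X$ is feasible if $|\sum_{k\in X}S_k|\le C$, and its utility is $u(X)=\sum_{k\in X}u_k$. $\mathrm{Opt}$ is the maximum utility of a feasible set. A solution has worst-case guarantee (approximation ratio) $\alpha\in[0,1]$ if it is feasible and its utility is at least $\alpha\cdot\mathrm{Opt}$. The angle between two nonzero complex numbers is their angle as vectors in $\mathbb R^2$, taken in $[0,\pi]$; $\theta$ is the maximum of these angles over all pairs (the maximum difference between the phase angles of any pair of demands). Greedy Ratio Algorithm (GRA): (1) Sort (relabel) the customers so that $\frac{u_1}{|S_1|}\ge\frac{u_2}{|S_2|}\ge\dots\ge\frac{u_n}{|S_n|}$, ties broken arbitrarily. (2) Start with $X=\emptyset$; for $k=1,2,\dots,n$ in this order, add $k$ to $X$ if $\big|\sum_{j\in X\cup\{k\}}S_j\big|\le C$, and otherwise skip $k$. (3) Find a single customer $k^\star$ with $u_{k^\star}=\max_{k\in\mathcal N}u_k$. (4) Output whichever of $X$ and $\{k^\star\}$ has the higher utility. *)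

theory Defs
  imports "HOL-Analysis.Analysis"
begin

text \<open>An instance of UMDR: the customers are \<open>{1..n}\<close>, with capacity \<open>C\<close>, utilities \<open>u\<close> and
  complex demands \<open>S\<close>. A 0/1 vector is identified with the set of customers it selects.\<close>

definition umdr_feasible :: "nat \<Rightarrow> real \<Rightarrow> (nat \<Rightarrow> complex) \<Rightarrow> nat set \<Rightarrow> bool" where
  "umdr_feasible n C S X \<longleftrightarrow> X \<subseteq> {1..n} \<and> cmod (\<Sum>k\<in>X. S k) \<le> C"

definition umdr_opt :: "nat \<Rightarrow> real \<Rightarrow> (nat \<Rightarrow> real) \<Rightarrow> (nat \<Rightarrow> complex) \<Rightarrow> real" where
  "umdr_opt n C u S = Max {(\<Sum>k\<in>X. u k) | X. umdr_feasible n C S X}"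

text \<open>The unsigned angle, in \<open>[0, pi]\<close>, between two nonzero vectors of the plane.\<close>

definition complex_angle :: "complex \<Rightarrow> complex \<Rightarrow> real" where
  "complex_angle z w = arccos (inner z w / (cmod z * cmod w))"

text \<open>Pairs of equal indices are included, so that the maximum is \<open>0\<close> when there is only one
  customer; for nonzero demands they contribute only the angle \<open>0\<close>.\<close>

definition max_angle :: "nat \<Rightarrow> (nat \<Rightarrow> complex) \<Rightarrow> real" where
  "max_angle n S = Max {complex_angle (S j) (S k) | j k. j \<in> {1..n} \<and> k \<in> {1..n}}"

definition greedy_select :: "real \<Rightarrow> (nat \<Rightarrow> complex) \<Rightarrow> nat list \<Rightarrow> nat set" where
  "greedy_select C S ks =
     fold (\<lambda>k X. if cmod (\<Sum>j\<in>insert k X. S j) \<le> C then insert k X else X) ks {}"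

text \<open>\<open>GRA_output n C u S Y\<close>: some run of the Greedy Ratio Algorithm outputs \<open>Y\<close>. It is a relation
  because ties may be broken arbitrarily: in the order \<open>ks\<close> in which the customers are considered,
  in the choice of the customer \<open>kstar\<close> of maximum utility, and in the final comparison. The
  relabelling of the customers is represented by the list \<open>ks\<close> of their original labels.\<close>

definition GRA_output :: "nat \<Rightarrow> real \<Rightarrow> (nat \<Rightarrow> real) \<Rightarrow> (nat \<Rightarrow> complex) \<Rightarrow> nat set \<Rightarrow> bool" where
  "GRA_output n C u S Y \<longleftrightarrow>
     (\<exists>ks kstar.
        distinct ks \<and> set ks = {1..n} \<and>
        sorted_wrt (\<lambda>j k. u j / cmod (S j) \<ge> u k / cmod (S k)) ks \<and>
        kstar \<in> {1..n} \<and> u kstar = Max (u ` {1..n}) \<and>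
        Y \<in> {greedy_select C S ks, {kstar}} \<and>
        (\<Sum>k\<in>Y. u k) = max (\<Sum>k\<in>greedy_select C S ks. u k) (\<Sum>k\<in>{kstar}. u k))"

lemma GRA_output_exists:
  assumes "n \<ge> 1"
  shows "\<exists>Y. GRA_output n C u S Y"
proof -
  define ks where "ks = sort_key (\<lambda>k. - (u k / cmod (S k))) [1..<Suc n]"
  have "sorted (map (\<lambda>k. - (u k / cmod (S k))) ks)"
    unfolding ks_def by (rule sorted_sort_key)
  then have s: "sorted_wrt (\<lambda>j k. u j / cmod (S j) \<ge> u k / cmod (S k)) ks"
    by (simp add: sorted_map)
  have d: "distinct ks" "set ks = {1..n}"
    by (auto simp: ks_def)
  have "Max (u ` {1..n}) \<in> u ` {1..n}"
    using assms by (intro Max_in) auto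
  then obtain kstar where k: "kstar \<in> {1..n}" "u kstar = Max (u ` {1..n})"
    by force
  let ?X = "greedy_select C S ks"
  let ?Y = "if (\<Sum>k\<in>?X. u k) \<ge> (\<Sum>k\<in>{kstar}. u k) then ?X else {kstar}"
  have "?Y \<in> {?X, {kstar}}"
       "(\<Sum>k\<in>?Y. u k) = max (\<Sum>k\<in>?X. u k) (\<Sum>k\<in>{kstar}. u k)"
    by (auto simp: max_def)
  with s d k show ?thesis
    unfolding GRA_output_def by blast
qed

end

theory Submission
  imports Defs
begin

text \<open>Put \<open>c = cos (\<theta> / 2)\<close>. Demands whose pairwise angles are at most \<open>\<theta> \<le> \<pi> / 2\<close> lie in a
  sector of opening \<open>\<theta>\<close>, and projecting onto the bisector of that sector shows that the
  length of their sum is at least \<open>c\<close> times their total length (\<open>cos_half_angle_sum_norm_le\<close>). Hence UMDR is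
  caught between two knapsack problems with weights \<open>|S k|\<close>: a feasible set \<open>Z\<close> has
  \<open>c * (\<Sum>k\<in>Z. |S k|) \<le> C\<close>, while by the triangle inequality a set that violates the capacity
  constraint weighs more than \<open>C\<close>.

  Run the greedy selection up to the first customer \<open>r\<close> that it skips. The customers before \<open>r\<close>
  have all been selected, and together with \<open>r\<close> they form a set \<open>P\<close> that violates the
  constraint. So \<open>P\<close> weighs at least \<open>c\<close> times as much as any feasible \<open>Z\<close>; since \<open>P\<close> consists of
  the customers of best ratio \<open>u k / |S k|\<close>, its utility is also at least \<open>c\<close> times that of \<open>Z\<close>
  (\<open>density_exchange\<close>). Finally \<open>u(P) \<le> u(X) + u r\<close>, where \<open>X\<close> is the greedy set, and
  \<open>u r\<close> is at most the utility of the best single customer, so the better of the two candidates has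
  at least half of \<open>u(P)\<close>. If no customer is skipped, then \<open>X\<close> is the set of all customers.\<close>

section \<open>Vectors with small pairwise angles\<close>

lemma inner_rcis: "inner (rcis r a) (rcis s b) = r * s * cos (a - b)"
  by (simp add: inner_complex_def cos_diff algebra_simps)

text \<open>For nonzero demands, an upper bound on the angle is a lower bound on the inner product; the
  Cauchy--Schwarz inequality puts the argument of \<open>arccos\<close> into its domain.\<close>

lemma inner_ge_of_complex_angle_le:
  assumes "z \<noteq> 0" "w \<noteq> 0" "complex_angle z w \<le> \<theta>" "\<theta> \<le> pi"
  shows "cmod z * cmod w * cos \<theta> \<le> inner z w"
proof -
  let ?x = "inner z w / (cmod z * cmod w)"
  have pos: "cmod z * cmod w > 0"
    using assms by simp
  have "\<bar>inner z w\<bar> \<le> cmod z * cmod w"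
    by (rule Cauchy_Schwarz_ineq2)
  then have x: "-1 \<le> ?x" "?x \<le> 1"
    using pos by (simp_all only: le_divide_eq divide_le_eq, auto)
  have "cos \<theta> \<le> cos (arccos ?x)"
    using assms(3,4) arccos_lbound[OF x] unfolding complex_angle_def
    by (intro cos_monotone_0_pi_le) auto
  then have "cos \<theta> \<le> ?x"
    using x by simp
  then show ?thesis
    using pos by (simp only: le_divide_eq) (simp add: mult.commute)
qed

text \<open>The bound \<open>cos \<theta>\<close> on each pair alone would only give \<open>sqrt (cos \<theta>)\<close> in place of
  \<open>cos (\<theta> / 2)\<close>. The better factor uses that the vectors are in a plane: measured from one of
  the vectors, all arguments lie in \<open>[-\<pi>/2, \<pi>/2]\<close>, so the extreme ones differ by at most \<open>\<pi>\<close>, and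
  their difference is a genuine angle between two of the vectors. The vectors are then within
  \<open>\<theta> / 2\<close> of the bisector of the two extreme ones.\<close>

lemma cos_half_angle_sum_norm_le:
  fixes S :: "'a \<Rightarrow> complex"
  assumes fin: "finite I" and nz: "\<And>k. k \<in> I \<Longrightarrow> S k \<noteq> 0"
    and \<theta>: "0 \<le> \<theta>" "\<theta> \<le> pi / 2"
    and pair: "\<And>j k. j \<in> I \<Longrightarrow> k \<in> I \<Longrightarrow> cmod (S j) * cmod (S k) * cos \<theta> \<le> inner (S j) (S k)"
  shows "cos (\<theta> / 2) * (\<Sum>k\<in>I. cmod (S k)) \<le> cmod (\<Sum>k\<in>I. S k)"
proof (cases "I = {}")
  case False
  then obtain p where p: "p \<in> I" by blast
  define a where "a = Arg (S p)"
  define t where "t k = Arg (S k / S p)" for k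
  have S_eq: "S k = rcis (cmod (S k)) (a + t k)" if "k \<in> I" for k
  proof -
    have "S k = S p * (S k / S p)"
      using nz[OF p] by simp
    also have "\<dots> = rcis (cmod (S p)) a * rcis (cmod (S k / S p)) (t k)"
      by (simp add: a_def t_def rcis_cmod_Arg)
    also have "\<dots> = rcis (cmod (S k)) (a + t k)"
      using nz[OF p] by (simp add: rcis_mult norm_divide)
    finally show ?thesis .
  qed
  have inner_eq: "inner (S j) (S k) = cmod (S j) * cmod (S k) * cos (t j - t k)"
    if "j \<in> I" "k \<in> I" for j k
    by (subst S_eq[OF that(1)], subst S_eq[OF that(2)]) (simp add: inner_rcis)
  have cos_ge: "cos \<theta> \<le> cos (t j - t k)" if "j \<in> I" "k \<in> I" for j k
    using pair[OF that] inner_eq[OF that] nz that by (simp add: mult_le_cancel_left_pos)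
  have tp: "t p = 0"
    using nz[OF p] by (simp add: t_def)
  have t_range: "\<bar>t k\<bar> \<le> pi / 2" if k: "k \<in> I" for k
  proof (rule ccontr)
    assume "\<not> ?thesis"
    moreover have "\<bar>t k\<bar> \<le> pi"
      unfolding t_def using mpi_less_Arg[of "S k / S p"] Arg_le_pi[of "S k / S p"] by linarith
    ultimately have "cos \<bar>t k\<bar> < cos (pi / 2)"
      by (intro cos_monotone_0_pi) auto
    moreover have "0 \<le> cos \<theta>"
      using \<theta> by (intro cos_ge_zero) auto
    ultimately show False
      using cos_ge[OF k p] tp by simp
  qed
  define lo where "lo = Min (t ` I)"
  define hi where "hi = Max (t ` I)"
  have "lo \<in> t ` I" "hi \<in> t ` I"
    unfolding lo_def hi_def using fin False by (auto intro!: Min_in Max_in)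
  then obtain i j where ij: "i \<in> I" "lo = t i" "j \<in> I" "hi = t j"
    by blast
  have between: "lo \<le> t k" "t k \<le> hi" if "k \<in> I" for k
    unfolding lo_def hi_def using fin that by auto
  have width: "hi - lo \<le> \<theta>"
  proof (rule ccontr)
    assume "\<not> ?thesis"
    then have "cos (hi - lo) < cos \<theta>"
      using \<theta> t_range[OF ij(1)] t_range[OF ij(3)] ij by (intro cos_monotone_0_pi) auto
    then show False
      using cos_ge[OF ij(3,1)] ij by simp
  qed
  define m where "m = (lo + hi) / 2"
  define e where "e = cis (a + m)"
  have proj: "cos (\<theta> / 2) * cmod (S k) \<le> inner (S k) e" if k: "k \<in> I" for k
  proof -
    have dev: "\<bar>t k - m\<bar> \<le> \<theta> / 2"
      using between[OF k] width unfolding m_def by (auto simp: abs_le_iff field_simps)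
    have "cos (\<theta> / 2) \<le> cos \<bar>t k - m\<bar>"
      using dev \<theta> by (intro cos_monotone_0_pi_le) auto
    moreover have "inner (S k) e = cmod (S k) * cos (t k - m)"
      by (subst S_eq[OF k]) (simp add: e_def cis_rcis_eq inner_rcis)
    ultimately show ?thesis
      by (simp add: mult.commute mult_left_mono)
  qed
  have "cos (\<theta> / 2) * (\<Sum>k\<in>I. cmod (S k)) \<le> (\<Sum>k\<in>I. inner (S k) e)"
    unfolding sum_distrib_left by (rule sum_mono) (rule proj)
  also have "\<dots> = inner (\<Sum>k\<in>I. S k) e"
    by (simp add: inner_sum_left)
  also have "\<dots> \<le> cmod (\<Sum>k\<in>I. S k) * cmod e"
    by (rule norm_cauchy_schwarz)
  finally show ?thesis
    by (simp add: e_def)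
qed simp

section \<open>Fractional relaxation of the knapsack problem\<close>

text \<open>Scaled by \<open>c\<close>, the set \<open>Z\<close> is a fractional solution that weighs no more than \<open>P\<close>. Turning
  \<open>P\<close> into it gives up the fraction \<open>1 - c\<close> or \<open>1\<close> of each item of \<open>P\<close>, at density at least \<open>\<rho>\<close>,
  and gains no more weight than that outside \<open>P\<close>, at density at most \<open>\<rho>\<close>.\<close>

lemma density_exchange:
  fixes u w :: "'a \<Rightarrow> real"
  assumes fin: "finite P" "finite Z" and c: "0 \<le> c" "c \<le> 1" and \<rho>: "0 \<le> \<rho>"
    and dense: "\<And>k. k \<in> P \<Longrightarrow> \<rho> * w k \<le> u k"
    and sparse: "\<And>k. k \<in> Z - P \<Longrightarrow> u k \<le> \<rho> * w k"
    and weight: "c * sum w Z \<le> sum w P"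
  shows "c * sum u Z \<le> sum u P"
proof -
  \<comment> \<open>\<open>q k\<close> is the fraction of item \<open>k \<in> P\<close> that is given up.\<close>
  define q where "q k = (if k \<in> Z then 1 - c else 1)" for k
  have split_P: "sum f P = c * sum f (Z \<inter> P) + (\<Sum>k\<in>P. q k * f k)" for f :: "'a \<Rightarrow> real"
  proof -
    have "(\<Sum>k\<in>P. q k * f k) = (\<Sum>k\<in>P. f k - (if k \<in> Z then c * f k else 0))"
      by (intro sum.cong) (auto simp: q_def algebra_simps)
    also have "\<dots> = sum f P - (\<Sum>k\<in>P \<inter> Z. c * f k)"
      using fin(1) by (simp add: sum_subtractf sum.inter_restrict)
    finally show ?thesis
      by (simp add: sum_distrib_left Int_commute)
  qed
  have split_Z: "sum f Z = sum f (Z \<inter> P) + sum f (Z - P)" for f :: "'a \<Rightarrow> real"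
    using fin(2) by (simp add: sum.Int_Diff[symmetric])
  have "c * sum u (Z - P) \<le> c * (\<Sum>k\<in>Z - P. \<rho> * w k)"
    using c sparse by (intro mult_left_mono sum_mono) auto
  also have "\<dots> = \<rho> * (c * sum w (Z - P))"
    by (simp add: sum_distrib_left algebra_simps)
  also have "\<dots> \<le> \<rho> * (\<Sum>k\<in>P. q k * w k)"
    using weight split_P[of w] split_Z[of w] \<rho>
    by (intro mult_left_mono) (auto simp: algebra_simps)
  also have "\<dots> = (\<Sum>k\<in>P. q k * (\<rho> * w k))"
    by (simp add: sum_distrib_left algebra_simps)
  also have "\<dots> \<le> (\<Sum>k\<in>P. q k * u k)"
    using c dense by (intro sum_mono mult_left_mono) (auto simp: q_def)
  finally show ?thesis
    using split_P[of u] split_Z[of u] by (simp add: algebra_simps)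
qed

section \<open>The greedy selection\<close>

lemma greedy_select_Nil: "greedy_select C S [] = {}"
  by (simp add: greedy_select_def)

lemma greedy_select_snoc:
  "greedy_select C S (ks @ [k]) =
     (let X = greedy_select C S ks
      in if cmod (\<Sum>j\<in>insert k X. S j) \<le> C then insert k X else X)"
  by (simp add: greedy_select_def Let_def)

lemma greedy_select_subset: "greedy_select C S ks \<subseteq> set ks"
  by (induction ks rule: rev_induct)
    (auto simp: greedy_select_Nil greedy_select_snoc Let_def split: if_splits)

lemma greedy_select_capacity: "0 \<le> C \<Longrightarrow> cmod (\<Sum>k\<in>greedy_select C S ks. S k) \<le> C"
  by (induction ks rule: rev_induct)
    (auto simp: greedy_select_Nil greedy_select_snoc Let_def)

text \<open>Splitting at the first skipped customer is what makes the analysis work: only up to that point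
  is the selected set known exactly, namely as a prefix of the order of consideration.\<close>

lemma greedy_select_first_skip:
  "greedy_select C S ks = set ks \<or>
   (\<exists>as r bs. ks = as @ r # bs \<and> set as \<subseteq> greedy_select C S ks \<and>
      C < cmod (\<Sum>k\<in>insert r (set as). S k))"
proof (induction ks rule: rev_induct)
  case Nil
  show ?case by (simp add: greedy_select_Nil)
next
  case (snoc k ks)
  have mono: "greedy_select C S ks \<subseteq> greedy_select C S (ks @ [k])"
    by (auto simp: greedy_select_snoc Let_def)
  from snoc show ?case
  proof
    assume all: "greedy_select C S ks = set ks"
    show ?thesis
    proof (cases "cmod (\<Sum>j\<in>insert k (set ks). S j) \<le> C")
      case True
      then show ?thesis
        using all by (simp add: greedy_select_snoc)
    next
      case False
      then have "ks @ [k] = ks @ k # [] \<and> set ks \<subseteq> greedy_select C S (ks @ [k]) \<and>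
          C < cmod (\<Sum>j\<in>insert k (set ks). S j)"
        using all mono by simp
      then show ?thesis
        by blast
    qed
  next
    assume "\<exists>as r bs. ks = as @ r # bs \<and> set as \<subseteq> greedy_select C S ks \<and>
      C < cmod (\<Sum>k\<in>insert r (set as). S k)"
    then obtain as r bs where "ks = as @ r # bs" "set as \<subseteq> greedy_select C S ks"
        "C < cmod (\<Sum>k\<in>insert r (set as). S k)"
      by blast
    then have "ks @ [k] = as @ r # (bs @ [k]) \<and> set as \<subseteq> greedy_select C S (ks @ [k]) \<and>
        C < cmod (\<Sum>k\<in>insert r (set as). S k)"
      using mono by simp
    then show ?thesis
      by blast
  qed
qed

text \<open>The geometry enters this bound only through \<open>weight\<close>, the inequality that relates the length
  of a feasible sum to the capacity.\<close>

lemma greedy_select_utility: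
  fixes u :: "nat \<Rightarrow> real"
  assumes u: "\<And>k. k \<in> set ks \<Longrightarrow> 0 \<le> u k" and nz: "\<And>k. k \<in> set ks \<Longrightarrow> S k \<noteq> 0"
    and sorted: "sorted_wrt (\<lambda>j k. u j / cmod (S j) \<ge> u k / cmod (S k)) ks"
    and best: "\<And>k. k \<in> set ks \<Longrightarrow> u k \<le> M" "0 \<le> M"
    and c: "0 \<le> c" "c \<le> 1"
    and Z: "Z \<subseteq> set ks" and weight: "c * (\<Sum>k\<in>Z. cmod (S k)) \<le> C"
  shows "c * sum u Z \<le> sum u (greedy_select C S ks) + M"
proof -
  let ?X = "greedy_select C S ks"
  have finX: "finite ?X" and finZ: "finite Z"
    by (rule finite_subset[OF greedy_select_subset finite_set], rule finite_subset[OF Z finite_set])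
  have X_nonneg: "0 \<le> u k" if "k \<in> ?X" for k
    using that greedy_select_subset[of C S ks] u by blast
  from greedy_select_first_skip[of C S ks] show ?thesis
  proof
    assume X: "?X = set ks"
    have "c * sum u Z \<le> 1 * sum u Z"
      using c Z u by (intro mult_right_mono sum_nonneg) auto
    also have "\<dots> \<le> sum u ?X"
      using X Z u by (auto intro: sum_mono2)
    finally show ?thesis
      using best(2) by linarith
  next
    assume "\<exists>as r bs. ks = as @ r # bs \<and> set as \<subseteq> ?X \<and>
      C < cmod (\<Sum>k\<in>insert r (set as). S k)"
    then obtain as r bs where ks: "ks = as @ r # bs" and as: "set as \<subseteq> ?X"
        and over: "C < cmod (\<Sum>k\<in>insert r (set as). S k)"
      by blast
    let ?P = "insert r (set as)"
    let ?\<rho> = "u r / cmod (S r)"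
    have r: "r \<in> set ks"
      using ks by simp
    have "c * sum u Z \<le> sum u ?P"
    proof (rule density_exchange[where \<rho> = ?\<rho> and w = "\<lambda>k. cmod (S k)"])
      fix k assume k: "k \<in> ?P"
      then have "?\<rho> \<le> u k / cmod (S k)" "S k \<noteq> 0"
        using sorted nz unfolding ks by (auto simp: sorted_wrt_append)
      then show "?\<rho> * cmod (S k) \<le> u k"
        by (simp add: pos_le_divide_eq)
    next
      fix k assume k: "k \<in> Z - ?P"
      then have "k \<in> set bs"
        using Z ks by auto
      then have "u k / cmod (S k) \<le> ?\<rho>" "S k \<noteq> 0"
        using sorted nz unfolding ks by (auto simp: sorted_wrt_append)
      then show "u k \<le> ?\<rho> * cmod (S k)"
        by (simp add: pos_divide_le_eq)
    next
      have "cmod (\<Sum>k\<in>?P. S k) \<le> (\<Sum>k\<in>?P. cmod (S k))"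
        by (rule norm_sum)
      then show "c * (\<Sum>k\<in>Z. cmod (S k)) \<le> (\<Sum>k\<in>?P. cmod (S k))"
        using weight over by linarith
    qed (use finZ c u r in auto)
    also have "\<dots> \<le> sum u (set as) + u r"
      using u[OF r] by (simp add: sum.insert_if)
    also have "\<dots> \<le> sum u ?X + M"
      using as finX X_nonneg best(1)[OF r] by (intro add_mono sum_mono2) auto
    finally show ?thesis .
  qed
qed

section \<open>The guarantee\<close>

lemma complex_angle_le_max_angle:
  assumes "j \<in> {1..n}" "k \<in> {1..n}"
  shows "complex_angle (S j) (S k) \<le> max_angle n S"
proof -
  have "{complex_angle (S j) (S k) | j k. j \<in> {1..n} \<and> k \<in> {1..n}}
      \<subseteq> (\<lambda>(j, k). complex_angle (S j) (S k)) ` ({1..n} \<times> {1..n})"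
    by auto
  then have "finite {complex_angle (S j) (S k) | j k. j \<in> {1..n} \<and> k \<in> {1..n}}"
    by (rule finite_subset) simp
  then show ?thesis
    unfolding max_angle_def using assms by (intro Max_ge) auto
qed

lemma umdr_opt_attained:
  assumes "0 \<le> C"
  obtains Z where "umdr_feasible n C S Z" "umdr_opt n C u S = sum u Z"
proof -
  let ?V = "{(\<Sum>k\<in>X. u k) | X. umdr_feasible n C S X}"
  have "?V \<subseteq> sum u ` Pow {1..n}"
    by (auto simp: umdr_feasible_def)
  then have "finite ?V"
    by (rule finite_subset) simp
  moreover have "umdr_feasible n C S {}"
    using assms by (simp add: umdr_feasible_def)
  then have "?V \<noteq> {}" by blast
  ultimately have "umdr_opt n C u S \<in> ?V"
    unfolding umdr_opt_def by (rule Max_in)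
  then show ?thesis
    using that by blast
qed

theorem theorem1:
  fixes n :: nat and C :: real and u :: "nat \<Rightarrow> real" and S :: "nat \<Rightarrow> complex"
    and \<theta> :: real and Xhat :: "nat set"
  assumes "n \<ge> 1"
    and "C > 0"
    and "\<And>k. k \<in> {1..n} \<Longrightarrow> u k \<ge> 0"
    and "\<And>k. k \<in> {1..n} \<Longrightarrow> S k \<noteq> 0"
    and "\<And>k. k \<in> {1..n} \<Longrightarrow> cmod (S k) \<le> C"
    and "\<theta> = max_angle n S"
    and "0 \<le> \<theta>" and "\<theta> \<le> pi / 2"
    and "GRA_output n C u S Xhat"
  shows "umdr_feasible n C S Xhat \<and>
    (\<Sum>k\<in>Xhat. u k) \<ge> 1 / 2 * cos (\<theta> / 2) * umdr_opt n C u S"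
proof -
  obtain ks kstar where ks: "set ks = {1..n}"
      "sorted_wrt (\<lambda>j k. u j / cmod (S j) \<ge> u k / cmod (S k)) ks"
    and kstar: "kstar \<in> {1..n}" "u kstar = Max (u ` {1..n})"
    and out: "Xhat \<in> {greedy_select C S ks, {kstar}}"
      "sum u Xhat = max (sum u (greedy_select C S ks)) (sum u {kstar})"
    using assms(9) unfolding GRA_output_def by (elim exE conjE) (rule that)
  have feasible: "umdr_feasible n C S Xhat"
    using out(1) kstar(1) greedy_select_subset[of C S ks] greedy_select_capacity[of C S ks]
      ks(1) assms(2,5)
    by (auto simp: umdr_feasible_def)
  obtain Z where Z: "umdr_feasible n C S Z" and opt: "umdr_opt n C u S = sum u Z"
    using umdr_opt_attained[of C n S u] assms(2) by auto
  then have Z_sub: "Z \<subseteq> {1..n}" and Z_cap: "cmod (\<Sum>k\<in>Z. S k) \<le> C"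
    by (auto simp: umdr_feasible_def)
  have "cos (\<theta> / 2) * (\<Sum>k\<in>Z. cmod (S k)) \<le> cmod (\<Sum>k\<in>Z. S k)"
  proof (rule cos_half_angle_sum_norm_le)
    fix j k assume "j \<in> Z" "k \<in> Z"
    then have jk: "j \<in> {1..n}" "k \<in> {1..n}"
      using Z_sub by auto
    show "cmod (S j) * cmod (S k) * cos \<theta> \<le> inner (S j) (S k)"
      using assms(4)[OF jk(1)] assms(4)[OF jk(2)] complex_angle_le_max_angle[OF jk, of S]
        assms(6,7,8) pi_gt_zero
      by (intro inner_ge_of_complex_angle_le) auto
  qed (use Z_sub assms(4,7,8) in \<open>auto intro: finite_subset\<close>)
  then have weight: "cos (\<theta> / 2) * (\<Sum>k\<in>Z. cmod (S k)) \<le> C"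
    using Z_cap by linarith
  have top: "u k \<le> u kstar" if "k \<in> {1..n}" for k
    using that unfolding kstar(2) by (intro Max_ge) auto
  have "cos (\<theta> / 2) * sum u Z \<le> sum u (greedy_select C S ks) + u kstar"
  proof (rule greedy_select_utility)
    show "0 \<le> cos (\<theta> / 2)"
      using assms(7,8) by (intro cos_ge_zero) auto
  qed (use assms(3,4) ks kstar(1) top Z_sub weight in auto)
  then have "1 / 2 * cos (\<theta> / 2) * sum u Z \<le> sum u Xhat"
    using out(2) by (simp add: max_def split: if_splits)
  then show ?thesis
    using feasible opt by simp
qed

end
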